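(* Let $d\ge 2$ be an integer and let $G=(V,E)$ be a finite connected graph with vertices $v_1,\dots,v_n$ and edges $e_1,\dots,e_m$, where $e_i=(u_i,w_i)$. Given $\mathbf{y}=(y_{e_1},\dots,y_{e_m})\in\mathbb{G}_d^m$, there exists $\mathbf{x}=(x_{v_1},\dots,x_{v_n})\in\mathbb{G}_d^n$ with $y_{e_i}=x_{u_i}x_{w_i}$ for every $i=1,\dots,m$ if and only if $\mathbf{y}^{\mathbf{u}}=1$ for every $\mathbf{u}\in\ker_{\mathbb{Z}_d}(A_G)$. Moreover, when such $\mathbf{x}$ exists: if $g=0$ there are exactly $d$ such $\mathbf{x}\in\mathbb{G}_d^n$; if $g=2$ and $d$ is even there are exactly two; otherwise there is exactly one.
   Context: $\mathbb{G}_d\subset\mathbb{C}$ is the group of $d$-th roots of unity. $A_G\in\mathbb{Z}^{n\times m}$ is the incidence matrix of $G$: entry $(i,j)$ is $1$ if $v_i$ is incident with $e_j$, $0$ otherwise. $\ker_{\mathbb{Z}_d}(A_G)=\{\mathbf{u}\in\mathbb{Z}_d^m : A_G\mathbf{u}\equiv0\pmod d\}$, and for $\mathbf{u}=(u_1,\dots,u_m)$ we write $\mathbf{y}^{\mathbf{u}}=y_{e_1}^{u_1}\cdots y_{e_m}^{u_m}$ (well defined since $y_{e_i}^d=1$). $g$ denotes the gcd of all maximal ($n\times n$) minors of $A_G$ (with $g=0$ if all of them vanish or there are none). *)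

theory Defs
  imports
    Complex_Main
    "HOL-Library.FuncSet"
    "HOL-Number_Theory.Cong"
    "Jordan_Normal_Form.Determinant"
    "Jordan_Normal_Form.DL_Submatrix"
begin

(* A finite undirected graph is given by the list vs of its vertices and the list es of its
   edges; a pair (u, w) in es is an edge joining u and w, and the order inside the pair carries no
   meaning. Loops are excluded: for a loop, y_e = x_u^2 does not match an incidence column
   with the single entry 1. Parallel edges are allowed, so simple graphs are a special case. *)

definition loopless_graph :: "'v list \<Rightarrow> ('v \<times> 'v) list \<Rightarrow> bool" where
  "loopless_graph vs es \<longleftrightarrow> distinct vs \<and> (\<forall>(u, w) \<in> set es. u \<in> set vs \<and> w \<in> set vs \<and> u \<noteq> w)"

definition connected_graph :: "'v list \<Rightarrow> ('v \<times> 'v) list \<Rightarrow> bool" where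
  "connected_graph vs es \<longleftrightarrow> loopless_graph vs es \<and> vs \<noteq> [] \<and>
     (\<forall>u \<in> set vs. \<forall>w \<in> set vs. (u, w) \<in> (set es \<union> (set es)\<inverse>)\<^sup>*)"

definition incident :: "'v \<Rightarrow> 'v \<times> 'v \<Rightarrow> bool" where
  "incident v e \<longleftrightarrow> v = fst e \<or> v = snd e"

definition incidence_matrix :: "'v list \<Rightarrow> ('v \<times> 'v) list \<Rightarrow> int mat" where
  "incidence_matrix vs es =
     mat (length vs) (length es) (\<lambda>(i, j). if incident (vs ! i) (es ! j) then 1 else 0)"

(* The minors on all rows. If there are fewer columns than rows, the set is empty. *)
definition maximal_minors :: "int mat \<Rightarrow> int set" where
  "maximal_minors A =
     {det (submatrix A {..<dim_row A} J) | J. J \<subseteq> {..<dim_col A} \<and> card J = dim_row A}"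

definition gcd_maximal_minors :: "int mat \<Rightarrow> int" where
  "gcd_maximal_minors A = Gcd (maximal_minors A)"

(* Elements of Z_d^m are represented by integer vectors with entries in {0, ..., d - 1}. *)
definition kernel_mod :: "nat \<Rightarrow> int mat \<Rightarrow> int vec set" where
  "kernel_mod d A =
     {u \<in> carrier_vec (dim_col A).
        (\<forall>j < dim_col A. 0 \<le> u $ j \<and> u $ j < int d) \<and>
        (\<forall>i < dim_row A. [(A *\<^sub>v u) $ i = 0] (mod int d))}"

definition roots_of_one :: "nat \<Rightarrow> complex set" where
  "roots_of_one d = {z. z ^ d = 1}"

(* The vectors x in G_d^n, indexed by the vertices; PiE makes them extensional, so that
   distinct functions are distinct vectors. *)
definition vertex_solutions ::
  "nat \<Rightarrow> 'v list \<Rightarrow> ('v \<times> 'v) list \<Rightarrow> (nat \<Rightarrow> complex) \<Rightarrow> ('v \<Rightarrow> complex) set" where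
  "vertex_solutions d vs es y =
     {x \<in> set vs \<rightarrow>\<^sub>E roots_of_one d.
        \<forall>i < length es. y i = x (fst (es ! i)) * x (snd (es ! i))}"

end

theory Submission
  imports Defs
begin

text \<open>
  Fix a root \<open>r\<close>. Adding up the edges of a walk from \<open>r\<close> to \<open>v\<close> with alternating signs gives an
  integer edge vector \<open>F v\<close> with \<open>A (F v) = e\<^sub>v - S v e\<^sub>r\<close>, where \<open>S v\<close> is a sign. Either the signs
  alternate along every edge (the graph is bipartite), or some integer vector \<open>h\<close> satisfies
  \<open>A h = 2 e\<^sub>r\<close>. A solution \<open>x\<close> satisfies \<open>y\<^sup>f = x\<^sup>A\<^sup>f\<close> for every integer vector \<open>f\<close>, so it is
  determined by \<open>x\<^sub>r\<close>, with \<open>x\<^sub>r\<close> free in the bipartite case and \<open>x\<^sub>r\<^sup>2 = y\<^sup>h\<close> otherwise. Conversely, if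
  \<open>y\<close> is trivial on the kernel mod \<open>d\<close>, then multiplying the monomial of \<open>F v\<close> by \<open>x\<^sub>r\<close> to the
  power \<open>S v\<close> defines a solution; the required square root of \<open>y\<^sup>h\<close> exists for even \<open>d\<close> because
  \<open>(d/2) h\<close> lies in the kernel mod \<open>d\<close>.

  The gcd of the maximal minors of \<open>A\<close> is \<open>0\<close> in the bipartite case because \<open>S\<close> is a relation between the
  rows. Otherwise it is even because all columns sum to \<open>2\<close>, and it divides \<open>2\<close> because, by
  multilinearity, it divides every \<open>det (A B)\<close>, in particular the one with columns
  \<open>2 e\<^sub>r\<close> and \<open>e\<^sub>v - S v e\<^sub>r\<close>.
\<close>

section \<open>Divisibility of maximal minors\<close>

text \<open>Multiplying the row vector \<open>w M\<close> by the adjugate of \<open>M\<close> gives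
  \<open>det M\<close> times \<open>w\<close>, so a common divisor of the entries of
  \<open>w M\<close> divides each entry of the result.\<close>

lemma dvd_det_of_left_combination:
  fixes M :: "int mat"
  assumes M: "M \<in> carrier_mat n n"
    and k: "\<And>j. j < n \<Longrightarrow> k dvd (\<Sum>i<n. w i * M $$ (i, j))"
    and i: "i < n"
  shows "k dvd w i * det M"
proof -
  have adj: "adj_mat M \<in> carrier_mat n n" "M * adj_mat M = det M \<cdot>\<^sub>m 1\<^sub>m n"
    using adj_mat[OF M] by auto
  have "w i * det M = (\<Sum>a<n. w a * (M * adj_mat M) $$ (a, i))"
    unfolding adj(2) using i by (simp add: if_distrib cong: if_cong)
  also have "\<dots> = (\<Sum>a<n. \<Sum>l<n. w a * M $$ (a, l) * adj_mat M $$ (l, i))"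
    using M adj(1) i
    by (intro sum.cong refl)
      (auto simp: scalar_prod_def sum_distrib_left mult.assoc atLeast0LessThan intro!: sum.cong)
  also have "\<dots> = (\<Sum>l<n. (\<Sum>a<n. w a * M $$ (a, l)) * adj_mat M $$ (l, i))"
    by (subst sum.swap) (simp add: sum_distrib_right)
  also have "k dvd \<dots>"
    by (rule dvd_sum, rule dvd_mult2, rule k) simp
  finally show ?thesis .
qed

lemma pick_lessThan:
  assumes "i < n"
  shows "pick {..<n} i = i"
  using assms pick_reduce_set[of i n UNIV] by (simp add: pick_UNIV lessThan_def)

lemma submatrix_all_rows:
  assumes A: "A \<in> carrier_mat n m" and J: "J \<subseteq> {..<m}" "card J = n"
  shows "submatrix A {..<n} J \<in> carrier_mat n n"
    and "\<And>i j. i < n \<Longrightarrow> j < n \<Longrightarrow> submatrix A {..<n} J $$ (i, j) = A $$ (i, pick J j)"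
    and "\<And>j. j < n \<Longrightarrow> pick J j < m"
proof -
  have *: "{i. i < dim_row A \<and> i \<in> {..<n}} = {..<n}" "{j. j < dim_col A \<and> j \<in> J} = J"
    using A J by auto
  show "submatrix A {..<n} J \<in> carrier_mat n n"
    unfolding carrier_mat_def by (simp add: dim_submatrix * J del: lessThan_iff)
  show "submatrix A {..<n} J $$ (i, j) = A $$ (i, pick J j)" if "i < n" "j < n" for i j
    using submatrix_index[of i A "{..<n}" j J] that J
    by (simp add: * pick_lessThan del: lessThan_iff)
  show "pick J j < m" if "j < n" for j
    using pick_in_set_le[of j J] that J by auto
qed

text \<open>Selecting columns preserves the hypothesis on the row combination, and the unit
  \<open>w i\<close> cancels. The case \<open>k = 0\<close> expresses that all minors
  vanish.\<close>

lemma dvd_gcd_maximal_minors: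
  assumes A: "A \<in> carrier_mat n m"
    and k: "\<And>j. j < m \<Longrightarrow> k dvd (\<Sum>i<n. w i * A $$ (i, j))"
    and i: "i < n" "is_unit (w i)"
  shows "k dvd gcd_maximal_minors A"
  unfolding gcd_maximal_minors_def
proof (rule Gcd_greatest)
  fix b assume "b \<in> maximal_minors A"
  then obtain J where J: "J \<subseteq> {..<m}" "card J = n" and b: "b = det (submatrix A {..<n} J)"
    using A by (auto simp: maximal_minors_def)
  note sub = submatrix_all_rows[OF A J]
  have "k dvd w i * b"
    unfolding b
    by (rule dvd_det_of_left_combination[OF sub(1) _ i(1)]) (use sub(2,3) k in auto)
  with i(2) show "k dvd b"
    by (simp add: dvd_mult_unit_iff')
qed

text \<open>A repeated column gives determinant 0; distinct columns give a maximal minor up to the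
  sign of a reordering. The selected columns are written as rows to match the expansion by rows used
  for \<open>det (A * B)\<close>.\<close>

lemma gcd_maximal_minors_dvd_det_columns:
  assumes A: "A \<in> carrier_mat n m" and \<phi>: "\<And>i. i < n \<Longrightarrow> \<phi> i < m"
  shows "gcd_maximal_minors A dvd det (mat n n (\<lambda>(i, k). A $$ (k, \<phi> i)))"
proof (cases "inj_on \<phi> {..<n}")
  case False
  then obtain i j where ij: "i < n" "j < n" "i \<noteq> j" "\<phi> i = \<phi> j"
    by (auto simp: inj_on_def)
  have "det (mat n n (\<lambda>(i, k). A $$ (k, \<phi> i))) = 0"
    by (rule det_identical_rows[OF _ ij(3,1,2)]) (use ij in \<open>auto intro!: eq_vecI\<close>)
  then show ?thesis by simp
next
  case inj: True
  define J where "J = \<phi> ` {..<n}"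
  have J: "J \<subseteq> {..<m}" "card J = n"
    using \<phi> inj by (auto simp: J_def card_image)
  have finJ: "finite J" by (simp add: J_def)
  note sub = submatrix_all_rows[OF A J]
  \<comment> \<open>\<open>q i\<close> is the rank of \<open>\<phi> i\<close> in \<open>J\<close>;
    fixing all \<open>i\<close> outside the range is what \<open>permutes\<close> requires.\<close>
  define q where "q i = (if i < n then card {a \<in> J. a < \<phi> i} else i)" for i
  have pick_q: "pick J (q i) = \<phi> i" if "i < n" for i
    using that by (simp add: q_def J_def pick_card_in_set)
  have q_less: "q i < n" if "i < n" for i
  proof -
    have "{a \<in> J. a < \<phi> i} \<subset> J" using that by (auto simp: J_def)
    from psubset_card_mono[OF finJ this] show ?thesis using that J by (simp add: q_def)
  qed
  have "inj_on q {0..<n}"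
  proof (rule inj_onI)
    fix i j assume "i \<in> {0..<n}" "j \<in> {0..<n}" "q i = q j"
    then show "i = j" using pick_q[of i] pick_q[of j] inj by (simp add: inj_on_def)
  qed
  then have "bij_betw q {0..<n} {0..<n}"
    using q_less by (intro bij_betw_imageI endo_inj_surj) auto
  then have perm: "q permutes {0..<n}"
    by (rule bij_imp_permutes) (simp add: q_def)
  let ?T = "transpose_mat (submatrix A {..<n} J)"
  have T: "?T \<in> carrier_mat n n" using sub(1) by simp
  have "mat n n (\<lambda>(i, k). A $$ (k, \<phi> i)) = mat n n (\<lambda>(i, k). ?T $$ (q i, k))"
    using sub q_less pick_q by (intro eq_matI) auto
  then have "det (mat n n (\<lambda>(i, k). A $$ (k, \<phi> i))) = signof q * det (submatrix A {..<n} J)"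
    using det_permute_rows[OF T perm] det_transpose[OF sub(1)] by simp
  moreover have "det (submatrix A {..<n} J) \<in> maximal_minors A"
    using A J by (auto simp: maximal_minors_def)
  ultimately show ?thesis
    by (simp add: gcd_maximal_minors_def)
qed

text \<open>A weak form of Cauchy-Binet: multilinearity in the rows of the transposed product gives
  a sum of multiples of determinants of chosen columns of \<open>A\<close>.\<close>

lemma gcd_maximal_minors_dvd_det_mult:
  assumes A: "A \<in> carrier_mat n m" and B: "B \<in> carrier_mat m n"
  shows "gcd_maximal_minors A dvd det (A * B)"
proof -
  let ?T = "transpose_mat"
  let ?\<Phi> = "{\<phi>. (\<forall>i\<in>{0..<n}. \<phi> i \<in> {0..<m}) \<and> (\<forall>i. i \<notin> {0..<n} \<longrightarrow> \<phi> i = i)}"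
  have AT: "?T A \<in> carrier_mat m n" and BT: "?T B \<in> carrier_mat n m"
    using A B by auto
  have "det (A * B) = det (?T B * ?T A)"
    using A B det_transpose[of "A * B" n] by (simp add: transpose_mult[OF A B])
  also have "\<dots> = (\<Sum>\<phi>\<in>?\<Phi>. det (mat\<^sub>r n n (\<lambda>i. ?T B $$ (i, \<phi> i) \<cdot>\<^sub>v row (?T A) (\<phi> i))))"
    unfolding mat_mul_finsum_alt[OF BT AT]
    by (rule det_linear_rows_sum) (use A in auto)
  also have "gcd_maximal_minors A dvd \<dots>"
  proof (rule dvd_sum)
    fix \<phi> assume \<phi>: "\<phi> \<in> ?\<Phi>"
    have "mat\<^sub>r n n (\<lambda>i. row (?T A) (\<phi> i)) = mat n n (\<lambda>(i, k). A $$ (k, \<phi> i))"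
      using A \<phi> by (intro eq_matI) auto
    moreover have "det (mat\<^sub>r n n (\<lambda>i. ?T B $$ (i, \<phi> i) \<cdot>\<^sub>v row (?T A) (\<phi> i))) =
        (\<Prod>i\<in>{0..<n}. ?T B $$ (i, \<phi> i)) * det (mat\<^sub>r n n (\<lambda>i. row (?T A) (\<phi> i)))"
      by (rule det_rows_mul, rule Pi_I, rule carrier_vecI) (simp add: carrier_matD[OF A])
    moreover have "gcd_maximal_minors A dvd det (mat n n (\<lambda>(i, k). A $$ (k, \<phi> i)))"
      using gcd_maximal_minors_dvd_det_columns[OF A] \<phi> by auto
    ultimately show "gcd_maximal_minors A dvd
        det (mat\<^sub>r n n (\<lambda>i. ?T B $$ (i, \<phi> i) \<cdot>\<^sub>v row (?T A) (\<phi> i)))"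
      by (simp add: dvd_mult)
  qed
  finally show ?thesis .
qed

section \<open>Boundaries of integer edge vectors\<close>

text \<open>The product of the incidence matrix with \<open>f\<close>, indexed by vertices instead
  of positions. It is unsigned, so cancellation along a walk needs alternating signs.\<close>

definition boundary :: "('v \<times> 'v) list \<Rightarrow> (nat \<Rightarrow> int) \<Rightarrow> 'v \<Rightarrow> int" where
  "boundary es f v = (\<Sum>i<length es. of_bool (incident v (es ! i)) * f i)"

lemma boundary_add: "boundary es (\<lambda>i. f i + g i) v = boundary es f v + boundary es g v"
  by (simp add: boundary_def distrib_left sum.distrib)

lemma boundary_diff: "boundary es (\<lambda>i. f i - g i) v = boundary es f v - boundary es g v"
  by (simp add: boundary_def right_diff_distrib sum_subtractf)

lemma boundary_scale: "boundary es (\<lambda>i. k * f i) v = k * boundary es f v"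
  unfolding boundary_def sum_distrib_left by (rule sum.cong) auto

lemma boundary_single:
  assumes "i < length es"
  shows "boundary es (\<lambda>j. of_bool (j = i)) v = of_bool (incident v (es ! i))"
proof -
  have "boundary es (\<lambda>j. of_bool (j = i)) v =
      (\<Sum>j\<in>{i}. of_bool (incident v (es ! j)) * of_bool (j = i))"
    unfolding boundary_def using assms by (intro sum.mono_neutral_right) auto
  then show ?thesis by simp
qed

lemma of_bool_incident:
  assumes "u \<noteq> w"
  shows "(of_bool (incident v (u, w)) :: int) = of_bool (v = u) + of_bool (v = w)"
  using assms by (auto simp: incident_def)

lemma incidence_matrix_mult:
  assumes "u \<in> carrier_vec (length es)" "i < length vs"
  shows "(incidence_matrix vs es *\<^sub>v u) $ i = boundary es (($) u) (vs ! i)"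
  using assms unfolding boundary_def
  by (subst index_mult_mat_vec)
    (auto simp: incidence_matrix_def scalar_prod_def atLeast0LessThan
      simp del: sum_of_bool_mult_eq intro!: sum.cong)

lemma loopless_edge:
  assumes "loopless_graph vs es" "(u, w) \<in> set es"
  shows "u \<in> set vs" "w \<in> set vs" "u \<noteq> w"
  using assms by (auto simp: loopless_graph_def)

text \<open>Adding up the edges of a walk from \<open>r\<close> to \<open>v\<close> with alternating signs cancels the
  contribution of every interior vertex.\<close>

lemma alternating_walk:
  assumes ll: "loopless_graph vs es" and walk: "(r, v) \<in> (set es \<union> (set es)\<inverse>)\<^sup>*"
  shows "\<exists>s f. (s = 1 \<or> s = - 1) \<and>
    (\<forall>w. boundary es f w = of_bool (w = v) - s * of_bool (w = r))"
  using walk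
proof (induction rule: rtrancl_induct)
  case base
  have "boundary es (\<lambda>_. 0) w = of_bool (w = r) - 1 * of_bool (w = r)" for w
    by (simp add: boundary_def)
  then show ?case by blast
next
  case (step v v')
  then obtain s f where s: "s = 1 \<or> s = - 1"
    and f: "\<And>w. boundary es f w = of_bool (w = v) - s * of_bool (w = r)" by blast
  from step.hyps(2) obtain i where i: "i < length es" "es ! i = (v, v') \<or> es ! i = (v', v)"
    by (auto simp: in_set_conv_nth)
  then have "(v, v') \<in> set es \<or> (v', v) \<in> set es" by (metis nth_mem)
  with ll have "v \<noteq> v'" using loopless_edge by metis
  then have "(of_bool (incident w (es ! i)) :: int) = of_bool (w = v) + of_bool (w = v')" for w
    using i(2) of_bool_incident[of v v' w] of_bool_incident[of v' v w] by auto
  \<comment> \<open>Subtracting the old vector from the new edge cancels the contribution at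
    \<open>v\<close>, leaves 1 at \<open>v'\<close> and flips the sign at \<open>r\<close>.\<close>
  then have "boundary es (\<lambda>j. of_bool (j = i) - f j) w = of_bool (w = v') - (- s) * of_bool (w = r)"
    for w by (simp add: boundary_diff boundary_single[OF i(1)] f)
  moreover have "- s = 1 \<or> - s = - 1" using s by auto
  ultimately show ?case by blast
qed

text \<open>The second alternative of the disjunction is the existence of an odd closed walk.\<close>

lemma connected_graph_cases:
  assumes con: "connected_graph vs es" and r: "r \<in> set vs"
  obtains S :: "'v \<Rightarrow> int" and F where "\<And>v. S v = 1 \<or> S v = - 1"
    and "\<And>v w. v \<in> set vs \<Longrightarrow> boundary es (F v) w = of_bool (w = v) - S v * of_bool (w = r)"
    and "(\<forall>(u, w) \<in> set es. S u + S w = 0) \<or> (\<exists>h. \<forall>w. boundary es h w = 2 * of_bool (w = r))"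
proof -
  have ll: "loopless_graph vs es" using con by (simp add: connected_graph_def)
  \<comment> \<open>Vertices outside \<open>set vs\<close> also receive a sign, so that
    \<open>S v\<close> is 1 or -1 without a side condition.\<close>
  have "\<forall>v. \<exists>s f. (s = (1::int) \<or> s = - 1) \<and>
      (v \<in> set vs \<longrightarrow> (\<forall>w. boundary es f w = of_bool (w = v) - s * of_bool (w = r)))"
  proof
    fix v
    show "\<exists>s f. (s = (1::int) \<or> s = - 1) \<and>
      (v \<in> set vs \<longrightarrow> (\<forall>w. boundary es f w = of_bool (w = v) - s * of_bool (w = r)))"
      using alternating_walk[OF ll, of r v] con r unfolding connected_graph_def
      by (cases "v \<in> set vs") blast+
  qed
  then obtain S F where S: "\<And>v. S v = (1::int) \<or> S v = - 1"
    and F: "\<And>v w. v \<in> set vs \<Longrightarrow> boundary es (F v) w = of_bool (w = v) - S v * of_bool (w = r)"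
    by metis
  have "\<exists>h. \<forall>w. boundary es h w = 2 * of_bool (w = r)"
    if uv: "(u, v) \<in> set es" "S u + S v \<noteq> 0" for u v
  proof -
    note e = loopless_edge[OF ll uv(1)]
    obtain i where i: "i < length es" "es ! i = (u, v)"
      using uv(1) unfolding in_set_conv_nth by blast
    have S_eq: "S u = S v" using uv(2) S[of u] S[of v] by auto
    have S_sq: "S v * S v = 1" using S[of v] by auto
    \<comment> \<open>Closing the walks to \<open>u\<close> and \<open>v\<close> with the edge
      between them leaves \<open>S u + S v = 2 * S v\<close> at the root; the outer factor
      \<open>S v\<close> normalises this to 2.\<close>
    have "boundary es (\<lambda>j. S v * (of_bool (j = i) - (F u j + F v j))) w = 2 * of_bool (w = r)" for w
    proof -
      have "boundary es (\<lambda>j. S v * (of_bool (j = i) - (F u j + F v j))) w =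
          2 * (S v * S v) * of_bool (w = r)"
        unfolding boundary_scale boundary_diff boundary_add boundary_single[OF i(1)] i(2)
          of_bool_incident[OF e(3)] F[OF e(1)] F[OF e(2)] S_eq
        by (cases "w = r") (simp_all add: algebra_simps)
      then show ?thesis by (simp add: S_sq)
    qed
    then show ?thesis by blast
  qed
  with S F show thesis by (intro that[of S F]) blast+
qed

section \<open>The gcd of the maximal minors of an incidence matrix\<close>

lemma incidence_matrix_carrier: "incidence_matrix vs es \<in> carrier_mat (length vs) (length es)"
  by (simp add: incidence_matrix_def)

lemma incidence_matrix_column_sum:
  assumes ll: "loopless_graph vs es" and j: "j < length es"
  shows "(\<Sum>i<length vs. c (vs ! i) * incidence_matrix vs es $$ (i, j)) =
    c (fst (es ! j)) + c (snd (es ! j))"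
proof -
  obtain u w where uw: "es ! j = (u, w)" by fastforce
  have e: "u \<in> set vs" "w \<in> set vs" "u \<noteq> w" and dist: "distinct vs"
    using ll loopless_edge[OF ll, of u w] uw j nth_mem[OF j] by (auto simp: loopless_graph_def)
  have "(\<Sum>i<length vs. c (vs ! i) * incidence_matrix vs es $$ (i, j)) =
      (\<Sum>i<length vs. c (vs ! i) * of_bool (incident (vs ! i) (u, w)))"
    using j uw by (intro sum.cong) (auto simp: incidence_matrix_def)
  also have "\<dots> = (\<Sum>v\<in>set vs. c v * of_bool (incident v (u, w)))"
    by (rule sum.reindex_bij_betw[OF bij_betw_nth[OF dist refl refl]])
  also have "\<dots> = (\<Sum>v\<in>{u, w}. c v)"
    using e by (intro sum.mono_neutral_cong_right) (auto simp: incident_def)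
  finally show ?thesis using e uw by simp
qed

lemma gcd_minors_bipartite:
  fixes S :: "'v \<Rightarrow> int"
  assumes ll: "loopless_graph vs es" and "vs \<noteq> []"
    and unit: "\<And>v. S v = 1 \<or> S v = - 1" and bip: "\<forall>(u, w) \<in> set es. S u + S w = 0"
  shows "gcd_maximal_minors (incidence_matrix vs es) = 0"
proof -
  \<comment> \<open>Divisibility by 0 means vanishing: the rows weighted by \<open>S\<close> add up
    to 0.\<close>
  have "0 dvd gcd_maximal_minors (incidence_matrix vs es)"
  proof (rule dvd_gcd_maximal_minors[OF incidence_matrix_carrier])
    show "0 dvd (\<Sum>i<length vs. S (vs ! i) * incidence_matrix vs es $$ (i, j))"
      if "j < length es" for j
      using bip nth_mem[OF that]
      by (simp add: incidence_matrix_column_sum[OF ll that] case_prod_beta)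
    show "0 < length vs" using \<open>vs \<noteq> []\<close> by simp
    show "is_unit (S (vs ! 0))" using unit[of "vs ! 0"] by auto
  qed
  then show ?thesis by simp
qed

lemma gcd_minors_non_bipartite:
  assumes ll: "loopless_graph vs es" and vs: "vs \<noteq> []"
    and F: "\<And>v w. v \<in> set vs \<Longrightarrow> boundary es (F v) w = of_bool (w = v) - S v * of_bool (w = hd vs)"
    and h: "\<And>w. boundary es h w = 2 * of_bool (w = hd vs)"
  shows "gcd_maximal_minors (incidence_matrix vs es) = 2"
proof -
  let ?A = "incidence_matrix vs es" and ?n = "length vs" and ?m = "length es"
  have dist: "distinct vs" using ll by (simp add: loopless_graph_def)
  note A = incidence_matrix_carrier[of vs es]
  have "2 dvd gcd_maximal_minors ?A"
    by (rule dvd_gcd_maximal_minors[OF A, where w = "\<lambda>_. 1" and i = 0])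
      (use vs incidence_matrix_column_sum[OF ll, where c = "\<lambda>_. 1"] in auto)
  moreover have "gcd_maximal_minors ?A dvd 2"
  proof -
    \<comment> \<open>The root has index 0. Using \<open>h\<close> there puts 2 in the corner, and
      the entries \<open>- S v\<close> of the other columns lie in row 0, so \<open>?A * B\<close>
      is upper triangular with diagonal 2, 1, ..., 1.\<close>
    define f where "f k = (if k = 0 then h else F (vs ! k))" for k
    define B where "B = mat ?m ?n (\<lambda>(j, k). f k j)"
    have B: "B \<in> carrier_mat ?m ?n" by (simp add: B_def)
    have AB: "?A * B \<in> carrier_mat ?n ?n" using A B by simp
    have entry: "(?A * B) $$ (i, k) = boundary es (f k) (vs ! i)" if "i < ?n" "k < ?n" for i k
      using that
      by (auto simp: incidence_matrix_def B_def boundary_def scalar_prod_def atLeast0LessThan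
          simp del: sum_of_bool_mult_eq intro!: sum.cong)
    have nth_eq_hd: "vs ! i = hd vs \<longleftrightarrow> i = 0" if "i < ?n" for i
      using that vs dist by (simp add: hd_conv_nth nth_eq_iff_index_eq)
    define D where "D = ?A * B"
    have D: "D \<in> carrier_mat ?n ?n" unfolding D_def by (rule AB)
    have val: "D $$ (i, k) = (if i = k then if i = 0 then 2 else 1 else
        if i = 0 then - S (vs ! k) else 0)" if ik: "i < ?n" "k < ?n" for i k
    proof (cases "k = 0")
      case True
      then show ?thesis unfolding D_def entry[OF ik] by (simp add: f_def h nth_eq_hd[OF ik(1)])
    next
      case False
      have "vs ! i = vs ! k \<longleftrightarrow> i = k" using dist ik by (rule nth_eq_iff_index_eq)
      then show ?thesis
        using False unfolding D_def entry[OF ik] f_def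
        by (simp add: F[OF nth_mem[OF ik(2)]] nth_eq_hd[OF ik(1)])
    qed
    have "det D = prod_list (diag_mat D)"
      by (rule det_upper_triangular[OF _ D]) (simp add: upper_triangular_def carrier_matD[OF D] val)
    also have "\<dots> = (\<Prod>i<?n. if i = 0 then 2 else 1)"
      using D by (simp add: prod_list_diag_prod atLeast0LessThan val)
    also have "\<dots> = 2" using vs by simp
    finally show ?thesis using gcd_maximal_minors_dvd_det_mult[OF A B] by (simp add: D_def)
  qed
  moreover have "gcd_maximal_minors ?A \<ge> 0" by (simp add: gcd_maximal_minors_def)
  ultimately show ?thesis by (simp add: zdvd_antisym_nonneg)
qed

section \<open>Monomials and vertex solutions\<close>

text \<open>Exponents are arbitrary integers because alternating walks produce negative
  entries.\<close>

definition monomial :: "nat \<Rightarrow> (nat \<Rightarrow> complex) \<Rightarrow> (nat \<Rightarrow> int) \<Rightarrow> complex" where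
  "monomial m y f = (\<Prod>i<m. y i powi f i)"

lemma monomial_add:
  assumes "\<And>i. i < m \<Longrightarrow> y i \<noteq> 0"
  shows "monomial m y (\<lambda>i. f i + g i) = monomial m y f * monomial m y g"
  using assms by (simp add: monomial_def power_int_add prod.distrib)

lemma monomial_diff:
  assumes "\<And>i. i < m \<Longrightarrow> y i \<noteq> 0"
  shows "monomial m y (\<lambda>i. f i - g i) = monomial m y f / monomial m y g"
  using assms by (simp add: monomial_def power_int_diff prod_dividef)

lemma power_int_prod: "(\<Prod>i\<in>I. f i) powi n = (\<Prod>i\<in>I. f i powi n)" for f :: "'a \<Rightarrow> complex"
  by (induction I rule: infinite_finite_induct) (simp_all add: power_int_mult_distrib)

lemma monomial_scale: "monomial m y (\<lambda>i. k * f i) = monomial m y f powi k"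
  by (simp add: monomial_def power_int_prod mult.commute[of k] power_int_mult)

lemma monomial_single:
  assumes "i < m"
  shows "monomial m y (\<lambda>j. of_bool (j = i)) = y i"
proof -
  have "monomial m y (\<lambda>j. of_bool (j = i)) = (\<Prod>j<m. if j = i then y j else 1)"
    unfolding monomial_def by (intro prod.cong) auto
  then show ?thesis using assms by simp
qed

lemma power_int_sum:
  assumes "x \<noteq> (0 :: complex)"
  shows "x powi (\<Sum>i\<in>I. f i) = (\<Prod>i\<in>I. x powi f i)"
  by (induction I rule: infinite_finite_induct) (simp_all add: power_int_add assms)

section \<open>Closure properties of the roots of unity\<close>

lemma roots_of_one_nonzero:
  assumes "d > 0" "z \<in> roots_of_one d"
  shows "z \<noteq> 0"
  using assms by (auto simp: roots_of_one_def power_0_left)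

lemma roots_of_one_mult:
  "z \<in> roots_of_one d \<Longrightarrow> w \<in> roots_of_one d \<Longrightarrow> z * w \<in> roots_of_one d"
  by (simp add: roots_of_one_def power_mult_distrib)

lemma roots_of_one_powi:
  assumes "z \<in> roots_of_one d"
  shows "z powi k \<in> roots_of_one d"
proof -
  have "(z powi k) ^ d = z powi (k * int d)" by (simp add: power_int_mult)
  also have "\<dots> = (z ^ d) powi k" by (simp add: power_int_power mult.commute)
  finally show ?thesis using assms by (simp add: roots_of_one_def)
qed

lemma roots_of_one_powi_eq_1:
  assumes "z \<in> roots_of_one d" "int d dvd k"
  shows "z powi k = 1"
  using assms by (auto simp: roots_of_one_def power_int_mult)

lemma monomial_in_roots_of_one:
  assumes "\<And>i. i < m \<Longrightarrow> y i \<in> roots_of_one d"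
  shows "monomial m y f \<in> roots_of_one d"
proof -
  have "(y i powi f i) ^ d = 1" if "i < m" for i
    using roots_of_one_powi[OF assms[OF that]] by (simp add: roots_of_one_def)
  then show ?thesis by (simp add: monomial_def roots_of_one_def prod_power_distrib)
qed

section \<open>Necessary conditions on a solution\<close>

lemma vertex_solutionsD:
  assumes "x \<in> vertex_solutions d vs es y"
  shows "v \<in> set vs \<Longrightarrow> x v \<in> roots_of_one d"
    and "i < length es \<Longrightarrow> y i = x (fst (es ! i)) * x (snd (es ! i))"
    and "x \<in> extensional (set vs)"
  using assms by (auto simp: vertex_solutions_def PiE_def)

text \<open>Substituting the edge equations for \<open>y\<close> and collecting the powers of each
  \<open>x v\<close> turns \<open>y^f\<close> into \<open>x^(A f)\<close>. The necessary conditions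
  below evaluate this identity for suitable \<open>f\<close>.\<close>

lemma monomial_eq_vertex_prod:
  assumes ll: "loopless_graph vs es" and d: "d > 0" and x: "x \<in> vertex_solutions d vs es y"
  shows "monomial (length es) y f = (\<Prod>v\<in>set vs. x v powi boundary es f v)"
proof -
  have nz: "x v \<noteq> 0" if "v \<in> set vs" for v
    using roots_of_one_nonzero[OF d vertex_solutionsD(1)[OF x that]] .
  have "(\<Prod>v\<in>set vs. x v powi boundary es f v) =
      (\<Prod>v\<in>set vs. \<Prod>i<length es. x v powi (of_bool (incident v (es ! i)) * f i))"
    unfolding boundary_def by (intro prod.cong refl power_int_sum nz)
  also have "\<dots> = (\<Prod>i<length es. \<Prod>v\<in>set vs. x v powi (of_bool (incident v (es ! i)) * f i))"
    by (rule prod.swap)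
  also have "\<dots> = (\<Prod>i<length es. y i powi f i)"
  proof (rule prod.cong[OF refl])
    fix i assume "i \<in> {..<length es}"
    then have i: "i < length es" by simp
    obtain u w where uw: "es ! i = (u, w)" by fastforce
    note e = loopless_edge[OF ll, of u w]
    have uw_in: "(u, w) \<in> set es" using i uw nth_mem by metis
    have "(\<Prod>v\<in>set vs. x v powi (of_bool (incident v (es ! i)) * f i)) =
        (\<Prod>v\<in>{u, w}. x v powi f i)"
      using e[OF uw_in] uw by (intro prod.mono_neutral_cong_right) (auto simp: incident_def)
    also have "\<dots> = y i powi f i"
      using e(3)[OF uw_in] vertex_solutionsD(2)[OF x i] uw by (simp add: power_int_mult_distrib)
    finally show "(\<Prod>v\<in>set vs. x v powi (of_bool (incident v (es ! i)) * f i)) = y i powi f i" .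
  qed
  finally show ?thesis by (simp add: monomial_def)
qed

lemma vertex_prod_two:
  fixes x :: "'v \<Rightarrow> complex"
  assumes "finite V" "v \<in> V" "r \<in> V" "\<And>w. w \<in> V \<Longrightarrow> x w \<noteq> 0"
  shows "(\<Prod>w\<in>V. x w powi (of_bool (w = v) - s * of_bool (w = r))) = x v / x r powi s"
proof -
  have "(\<Prod>w\<in>V. x w powi (of_bool (w = v) - s * of_bool (w = r))) =
      (\<Prod>w\<in>V. (if w = v then x w else 1) / (if w = r then x w powi s else 1))"
    using assms by (intro prod.cong) (auto simp: power_int_diff)
  then show ?thesis using assms by (simp add: prod_dividef)
qed

text \<open>Only the exponents at \<open>v\<close> and \<open>r\<close> survive, so the identity can
  be solved for \<open>x v\<close>: a solution is determined by its value at the root.\<close>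

lemma vertex_solution_value:
  assumes ll: "loopless_graph vs es" and d: "d > 0" and x: "x \<in> vertex_solutions d vs es y"
    and v: "v \<in> set vs" and r: "r \<in> set vs"
    and f: "\<And>w. boundary es f w = of_bool (w = v) - s * of_bool (w = r)"
  shows "x v = monomial (length es) y f * x r powi s"
proof -
  have nz: "x w \<noteq> 0" if "w \<in> set vs" for w
    using roots_of_one_nonzero[OF d vertex_solutionsD(1)[OF x that]] .
  have "monomial (length es) y f = x v / x r powi s"
    unfolding monomial_eq_vertex_prod[OF ll d x] f
    by (rule vertex_prod_two) (use v r nz in auto)
  then show ?thesis using nz[OF r] by simp
qed

lemma vertex_solution_square:
  assumes ll: "loopless_graph vs es" and d: "d > 0" and x: "x \<in> vertex_solutions d vs es y"
    and r: "r \<in> set vs" and h: "\<And>w. boundary es h w = 2 * of_bool (w = r)"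
  shows "monomial (length es) y h = (x r)\<^sup>2"
proof -
  have "monomial (length es) y h = (\<Prod>w\<in>set vs. if w = r then (x w)\<^sup>2 else 1)"
    unfolding monomial_eq_vertex_prod[OF ll d x] h by (intro prod.cong) auto
  then show ?thesis using r by simp
qed

text \<open>For \<open>u\<close> in the kernel, the exponent of every \<open>x v\<close> is a
  multiple of \<open>d\<close>.\<close>

lemma monomial_kernel_eq_1:
  assumes ll: "loopless_graph vs es" and d: "d > 0" and x: "x \<in> vertex_solutions d vs es y"
    and u: "u \<in> kernel_mod d (incidence_matrix vs es)"
  shows "(\<Prod>i<length es. y i powi (u $ i)) = 1"
proof -
  have dim: "u \<in> carrier_vec (length es)"
    using u by (simp add: kernel_mod_def incidence_matrix_def)
  have "int d dvd boundary es (($) u) v" if v: "v \<in> set vs" for v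
  proof -
    obtain i where i: "i < length vs" "vs ! i = v" using v unfolding in_set_conv_nth by blast
    then have "[(incidence_matrix vs es *\<^sub>v u) $ i = 0] (mod int d)"
      using u unfolding kernel_mod_def carrier_matD[OF incidence_matrix_carrier] by blast
    then show ?thesis
      unfolding incidence_matrix_mult[OF dim i(1)] i(2) cong_0_iff .
  qed
  then have "monomial (length es) y (($) u) = 1"
    unfolding monomial_eq_vertex_prod[OF ll d x]
    by (intro prod.neutral ballI roots_of_one_powi_eq_1[of _ d] vertex_solutionsD(1)[OF x]) auto
  then show ?thesis by (simp add: monomial_def)
qed

text \<open>Reduction mod \<open>d\<close> turns an integer vector with boundary divisible by \<open>d\<close> into an element of
  the kernel without changing the monomial.\<close>

lemma monomial_eq_1_of_kernel:
  assumes d: "d > 0" and y: "\<And>i. i < length es \<Longrightarrow> y i \<in> roots_of_one d"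
    and ker: "\<forall>u \<in> kernel_mod d (incidence_matrix vs es). (\<Prod>i<length es. y i powi (u $ i)) = 1"
    and f: "\<And>v. v \<in> set vs \<Longrightarrow> int d dvd boundary es f v"
  shows "monomial (length es) y f = 1"
proof -
  let ?A = "incidence_matrix vs es"
  define u where "u = vec (length es) (\<lambda>i. f i mod int d)"
  have dim: "u \<in> carrier_vec (length es)" by (simp add: u_def)
  have bd: "boundary es (($) u) v = boundary es f v - int d * boundary es (\<lambda>i. f i div int d) v" for v
  proof -
    have "boundary es (($) u) v = boundary es (\<lambda>i. f i - int d * (f i div int d)) v"
      unfolding boundary_def u_def by (intro sum.cong) (auto simp: minus_mult_div_eq_mod)
    then show ?thesis by (simp add: boundary_diff boundary_scale)
  qed
  have "u \<in> kernel_mod d ?A"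
    unfolding kernel_mod_def
  proof (intro CollectI conjI allI impI)
    show "u \<in> carrier_vec (dim_col ?A)" using dim by (simp add: incidence_matrix_def)
    show "0 \<le> u $ j" "u $ j < int d" if "j < dim_col ?A" for j
      using that d by (simp_all add: u_def incidence_matrix_def)
    show "[(?A *\<^sub>v u) $ i = 0] (mod int d)" if "i < dim_row ?A" for i
    proof -
      have i: "i < length vs" using that by (simp add: incidence_matrix_def)
      show ?thesis
        unfolding incidence_matrix_mult[OF dim i] bd cong_0_iff
        using f[OF nth_mem[OF i]] by (intro dvd_diff dvd_triv_left)
    qed
  qed
  with ker have "(\<Prod>i<length es. y i powi (u $ i)) = 1" by blast
  also have "(\<Prod>i<length es. y i powi (u $ i)) = monomial (length es) y f"
    unfolding monomial_def
  proof (rule prod.cong[OF refl])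
    fix i assume "i \<in> {..<length es}"
    then have i: "i < length es" by simp
    have "y i powi f i = y i powi (int d * (f i div int d) + f i mod int d)" by simp
    also have "\<dots> = y i powi (int d * (f i div int d)) * y i powi (f i mod int d)"
      using roots_of_one_nonzero[OF d y[OF i]] by (intro power_int_add) simp
    finally show "y i powi (u $ i) = y i powi f i"
      using i by (simp add: u_def roots_of_one_powi_eq_1[OF y[OF i]])
  qed
  finally show ?thesis .
qed

section \<open>Construction of a solution\<close>

lemma square_root_in_roots_of_one:
  assumes c: "c \<in> roots_of_one d" and even: "even d \<Longrightarrow> c ^ (d div 2) = 1"
  obtains z where "z \<in> roots_of_one d" "z\<^sup>2 = c"
proof (cases "even d")
  case True
  \<comment> \<open>Any complex square root of \<open>c\<close> works: its \<open>d\<close>-th power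
    is \<open>c ^ (d div 2)\<close>.\<close>
  then have "csqrt c ^ d = csqrt c ^ (2 * (d div 2))" by simp
  then have "csqrt c ^ d = 1" using even True by (simp only: power_mult power2_csqrt)
  then show thesis by (intro that[of "csqrt c"]) (simp_all add: roots_of_one_def)
next
  case False
  then obtain k where k: "d = 2 * k + 1" by (elim oddE)
  \<comment> \<open>\<open>k + 1\<close> is the inverse of 2 modulo
    \<open>d = 2 * k + 1\<close>.\<close>
  have "(c ^ (k + 1))\<^sup>2 = c ^ (d + 1)" unfolding power_mult[symmetric] k by (simp add: algebra_simps)
  also have "\<dots> = c" using c by (simp add: roots_of_one_def)
  finally have sq: "(c ^ (k + 1))\<^sup>2 = c" .
  have "c ^ (k + 1) \<in> roots_of_one d"
    using roots_of_one_powi[OF c, of "int (k + 1)"] by (simp only: power_int_of_nat)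
  with sq show thesis by (rule that[rotated])
qed

text \<open>The hypothesis \<open>edge\<close> is the edge equation of the candidate, rearranged so
  that all monomials stand on one side. Existence thus reduces to choosing the root value
  \<open>z\<close>.\<close>

lemma vertex_solution_from_root:
  assumes ll: "loopless_graph vs es" and d: "d > 0"
    and y: "\<And>i. i < length es \<Longrightarrow> y i \<in> roots_of_one d" and z: "z \<in> roots_of_one d"
    and edge: "\<And>i u w. i < length es \<Longrightarrow> es ! i = (u, w) \<Longrightarrow>
      monomial (length es) y (\<lambda>j. of_bool (j = i) - (F u j + F w j)) = z powi (S u + S w)"
  shows "(\<lambda>v\<in>set vs. monomial (length es) y (F v) * z powi S v) \<in> vertex_solutions d vs es y"
proof -
  let ?P = "monomial (length es) y"
  let ?x = "\<lambda>v. ?P (F v) * z powi S v"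
  have nz: "y i \<noteq> 0" if "i < length es" for i
    using roots_of_one_nonzero[OF d y[OF that]] .
  have P_nz: "?P f \<noteq> 0" for f
    using roots_of_one_nonzero[OF d monomial_in_roots_of_one[OF y]] .
  have z_nz: "z \<noteq> 0" using roots_of_one_nonzero[OF d z] .
  have "y i = ?x u * ?x w" if i: "i < length es" "es ! i = (u, w)" for i u w
  proof -
    have "y i / (?P (F u) * ?P (F w)) = z powi S u * z powi S w"
      using edge[OF i] z_nz
      by (simp add: monomial_diff monomial_add monomial_single i(1) nz power_int_add)
    then show ?thesis using P_nz by (simp add: field_simps)
  qed
  moreover have "fst (es ! i) \<in> set vs" "snd (es ! i) \<in> set vs" if "i < length es" for i
    using loopless_edge[OF ll, of "fst (es ! i)" "snd (es ! i)"] nth_mem[OF that] by auto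
  moreover have "?x v \<in> roots_of_one d" for v
    by (intro roots_of_one_mult monomial_in_roots_of_one roots_of_one_powi y z)
  ultimately show ?thesis
    by (auto simp: vertex_solutions_def)
qed

lemma vertex_solution_exists:
  assumes con: "connected_graph vs es" and d: "d > 0"
    and y: "\<And>i. i < length es \<Longrightarrow> y i \<in> roots_of_one d"
    and ker: "\<forall>u \<in> kernel_mod d (incidence_matrix vs es). (\<Prod>i<length es. y i powi (u $ i)) = 1"
  shows "\<exists>x. x \<in> vertex_solutions d vs es y"
proof -
  let ?P = "monomial (length es) y"
  have ll: "loopless_graph vs es" and r: "hd vs \<in> set vs"
    using con by (auto simp: connected_graph_def)
  have nz: "y i \<noteq> 0" if "i < length es" for i
    using roots_of_one_nonzero[OF d y[OF that]] .
  have P1: "?P f = 1" if "\<And>v. v \<in> set vs \<Longrightarrow> int d dvd boundary es f v" for f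
    using monomial_eq_1_of_kernel[OF d _ ker that] y by blast
  obtain S F where S: "\<And>v. S v = (1::int) \<or> S v = - 1"
    and F: "\<And>v w. v \<in> set vs \<Longrightarrow> boundary es (F v) w = of_bool (w = v) - S v * of_bool (w = hd vs)"
    and or: "(\<forall>(u, w) \<in> set es. S u + S w = 0) \<or> (\<exists>h. \<forall>w. boundary es h w = 2 * of_bool (w = hd vs))"
    by (rule connected_graph_cases[OF con r]) (rule that)
  \<comment> \<open>The edge minus the two walks has boundary only at the root.\<close>
  have bd: "boundary es (\<lambda>j. of_bool (j = i) - (F u j + F w j)) v = (S u + S w) * of_bool (v = hd vs)"
    and edge: "(u, w) \<in> set es"
    if i: "i < length es" "es ! i = (u, w)" for i u w v
  proof -
    show "(u, w) \<in> set es" using i nth_mem by metis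
    note e = loopless_edge[OF ll this]
    show "boundary es (\<lambda>j. of_bool (j = i) - (F u j + F w j)) v = (S u + S w) * of_bool (v = hd vs)"
      unfolding boundary_diff boundary_add boundary_single[OF i(1)] i(2)
        of_bool_incident[OF e(3)] F[OF e(1)] F[OF e(2)]
      by (cases "v = hd vs") simp_all
  qed
  from or show ?thesis
  proof
    assume bip: "\<forall>(u, w) \<in> set es. S u + S w = 0"
    \<comment> \<open>With opposite signs on every edge the root value is free; 1 is chosen.\<close>
    have "1 \<in> roots_of_one d" by (simp add: roots_of_one_def)
    moreover have "?P (\<lambda>j. of_bool (j = i) - (F u j + F w j)) = 1 powi (S u + S w)"
      if i: "i < length es" "es ! i = (u, w)" for i u w
    proof -
      have "S u + S w = 0" using bip edge[OF i] by blast
      then show ?thesis by (simp add: P1 bd[OF i])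
    qed
    ultimately show ?thesis
      by (intro exI) (rule vertex_solution_from_root[OF ll d y])
  next
    assume "\<exists>h. \<forall>w. boundary es h w = 2 * of_bool (w = hd vs)"
    then obtain h where h: "\<And>w. boundary es h w = 2 * of_bool (w = hd vs)" by blast
    have half: "?P h ^ (d div 2) = 1" if even: "even d"
    proof -
      \<comment> \<open>Since \<open>h\<close> has boundary 2 at the root, this multiple has
        boundary \<open>d\<close> there.\<close>
      have "?P (\<lambda>i. int (d div 2) * h i) = 1"
      proof (rule P1)
        obtain k where "d = 2 * k" using even by (elim evenE)
        then show "int d dvd boundary es (\<lambda>i. int (d div 2) * h i) v" for v
          unfolding boundary_scale h by simp
      qed
      then show ?thesis unfolding monomial_scale power_int_of_nat .
    qed
    have "?P h \<in> roots_of_one d" by (intro monomial_in_roots_of_one y)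
    then obtain z where z: "z \<in> roots_of_one d" "z\<^sup>2 = ?P h"
      by (rule square_root_in_roots_of_one[OF _ half])
    have "?P (\<lambda>j. of_bool (j = i) - (F u j + F w j)) = z powi (S u + S w)"
      if i: "i < length es" "es ! i = (u, w)" for i u w
    proof -
      have "even (S u + S w)" using S[of u] S[of w] by auto
      then obtain k where k: "S u + S w = 2 * k" by (elim evenE)
      \<comment> \<open>Subtracting \<open>k * h\<close> removes the boundary \<open>2 * k\<close>
        at the root, so the kernel condition applies.\<close>
      have "?P (\<lambda>j. of_bool (j = i) - (F u j + F w j) - k * h j) = 1"
        by (rule P1) (simp add: boundary_diff[where g = "\<lambda>j. k * h j"] boundary_scale bd[OF i] h k)
      then have "?P (\<lambda>j. of_bool (j = i) - (F u j + F w j)) = ?P (\<lambda>j. k * h j)"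
        by (simp add: monomial_diff[where g = "\<lambda>j. k * h j"] nz)
      also have "\<dots> = (z powi 2) powi k" by (simp add: monomial_scale z(2))
      finally show ?thesis unfolding k power_int_mult .
    qed
    with z(1) show ?thesis
      by (intro exI) (rule vertex_solution_from_root[OF ll d y])
  qed
qed

section \<open>Counting the solutions\<close>

text \<open>Here \<open>t\<close> solves the homogeneous system, whose right-hand sides are all 1.
  It will be \<open>t powi S v\<close> in the bipartite case and the constant -1 otherwise.\<close>

lemma vertex_solutions_twist:
  assumes ll: "loopless_graph vs es" and x: "x \<in> vertex_solutions d vs es y"
    and t: "\<And>v. v \<in> set vs \<Longrightarrow> t v \<in> roots_of_one d"
    and t1: "\<And>u w. (u, w) \<in> set es \<Longrightarrow> t u * t w = 1"
  shows "(\<lambda>v\<in>set vs. x v * t v) \<in> vertex_solutions d vs es y"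
proof -
  have "y i = x u * t u * (x w * t w)" "u \<in> set vs" "w \<in> set vs"
    if i: "i < length es" "es ! i = (u, w)" for i u w
  proof -
    have uw: "(u, w) \<in> set es" using i nth_mem by metis
    show "y i = x u * t u * (x w * t w)"
      using vertex_solutionsD(2)[OF x i(1)] t1[OF uw] i(2) by (simp add: mult_ac)
    show "u \<in> set vs" "w \<in> set vs" using loopless_edge[OF ll uw] by auto
  qed
  then have "y i = (\<lambda>v\<in>set vs. x v * t v) (fst (es ! i)) * (\<lambda>v\<in>set vs. x v * t v) (snd (es ! i))"
    if "i < length es" for i
    using that by (cases "es ! i") simp
  then show ?thesis
    using vertex_solutionsD(1)[OF x] t by (auto simp: vertex_solutions_def intro!: roots_of_one_mult)
qed

lemma roots_of_one_finite_card:
  assumes "d > 0"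
  shows "finite (roots_of_one d)" "card (roots_of_one d) = d"
  using assms card_roots_unity_eq[of d] card_ge_0_finite[of "{z::complex. z ^ d = 1}"]
  by (auto simp: roots_of_one_def)

lemma card_vertex_solutions:
  assumes con: "connected_graph vs es" and d: "d > 0" and x: "x \<in> vertex_solutions d vs es y"
    and g: "g = gcd_maximal_minors (incidence_matrix vs es)"
  shows "card (vertex_solutions d vs es y) = (if g = 0 then d else if g = 2 \<and> even d then 2 else 1)"
proof -
  let ?P = "monomial (length es) y" and ?r = "hd vs" and ?X = "vertex_solutions d vs es y"
  have ll: "loopless_graph vs es" and ne: "vs \<noteq> []" and r: "?r \<in> set vs"
    using con by (auto simp: connected_graph_def)
  have nz: "x' v \<noteq> 0" if "x' \<in> ?X" "v \<in> set vs" for x' v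
    using roots_of_one_nonzero[OF d vertex_solutionsD(1)[OF that]] .
  obtain S F where S: "\<And>v. S v = (1::int) \<or> S v = - 1"
    and F: "\<And>v w. v \<in> set vs \<Longrightarrow> boundary es (F v) w = of_bool (w = v) - S v * of_bool (w = ?r)"
    and or: "(\<forall>(u, w) \<in> set es. S u + S w = 0) \<or> (\<exists>h. \<forall>w. boundary es h w = 2 * of_bool (w = ?r))"
    by (rule connected_graph_cases[OF con r]) (rule that)
  \<comment> \<open>Evaluation at the root is injective, so counting solutions means counting their
    root values.\<close>
  have inj: "x1 = x2" if "x1 \<in> ?X" "x2 \<in> ?X" "x1 ?r = x2 ?r" for x1 x2
  proof (rule extensionalityI)
    show "x1 v = x2 v" if "v \<in> set vs" for v
      using vertex_solution_value[OF ll d _ that r F[OF that]] \<open>x1 \<in> ?X\<close> \<open>x2 \<in> ?X\<close> \<open>x1 ?r = x2 ?r\<close>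
      by metis
  qed (use that vertex_solutionsD(3) in blast)+
  from or show ?thesis
  proof
    assume bip: "\<forall>(u, w) \<in> set es. S u + S w = 0"
    then have "g = 0" using gcd_minors_bipartite[OF ll ne S] g by simp
    define T where "T t = (\<lambda>v\<in>set vs. x v * t powi S v)" for t
    have T: "T t \<in> ?X" if t: "t \<in> roots_of_one d" for t
      unfolding T_def
    proof (rule vertex_solutions_twist[OF ll x])
      show "t powi S v \<in> roots_of_one d" for v by (rule roots_of_one_powi[OF t])
      show "t powi S u * t powi S w = 1" if "(u, w) \<in> set es" for u w
        using bip that roots_of_one_nonzero[OF d t] by (auto simp flip: power_int_add)
    qed
    have "inj_on T (roots_of_one d)"
    proof (rule inj_onI)
      fix t t' assume "T t = T t'"
      then have "T t ?r = T t' ?r" by simp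
      then have "t powi S ?r = t' powi S ?r" using r nz[OF x r] by (simp add: T_def)
      then show "t = t'" using S[of ?r] by auto
    qed
    moreover have injr: "inj_on (\<lambda>x. x ?r) ?X" using inj by (intro inj_onI)
    moreover have im: "(\<lambda>x. x ?r) ` ?X \<subseteq> roots_of_one d" using vertex_solutionsD(1)[OF _ r] by blast
    moreover have "finite ?X"
      using inj_on_finite[OF injr im roots_of_one_finite_card(1)[OF d]] .
    \<comment> \<open>Evaluation at the root and \<open>T\<close> are injections in opposite
      directions.\<close>
    ultimately have "card ?X = card (roots_of_one d)"
      using T roots_of_one_finite_card(1)[OF d] by (intro antisym card_inj_on_le) auto
    then show ?thesis using \<open>g = 0\<close> roots_of_one_finite_card(2)[OF d] by simp
  next
    assume "\<exists>h. \<forall>w. boundary es h w = 2 * of_bool (w = ?r)"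
    then obtain h where h: "\<And>w. boundary es h w = 2 * of_bool (w = ?r)" by blast
    have "g = 2" using gcd_minors_non_bipartite[OF ll ne F h] g by simp
    have pm: "x' ?r = x ?r \<or> x' ?r = - x ?r" if "x' \<in> ?X" for x'
      using vertex_solution_square[OF ll d that r h] vertex_solution_square[OF ll d x r h]
      by (metis power2_eq_iff)
    show ?thesis
    proof (cases "even d")
      case True
      \<comment> \<open>The constant -1 is a \<open>d\<close>-th root of unity because
        \<open>d\<close> is even.\<close>
      define x' where "x' = (\<lambda>v\<in>set vs. x v * - 1)"
      have x': "x' \<in> ?X"
        unfolding x'_def using True
        by (intro vertex_solutions_twist[OF ll x]) (simp_all add: roots_of_one_def)
      have x'r: "x' ?r = - x ?r" using r by (simp add: x'_def)
      then have "x' \<noteq> x" using nz[OF x r] by auto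
      moreover have "?X = {x, x'}"
        using x x' pm inj x'r by (intro equalityI subsetI) (metis insert_iff, blast)
      ultimately show ?thesis using \<open>g = 2\<close> True by simp
    next
      case False
      \<comment> \<open>For odd \<open>d\<close> the negative of a \<open>d\<close>-th root of unity
        has \<open>d\<close>-th power -1, which excludes the second sign.\<close>
      have "x' ?r = x ?r" if "x' \<in> ?X" for x'
        using pm[OF that] vertex_solutionsD(1)[OF that r] vertex_solutionsD(1)[OF x r] False
        by (auto simp: roots_of_one_def)
      then have "?X = {x}" using x inj by blast
      then show ?thesis using \<open>g = 2\<close> False by simp
    qed
  qed
qed

theorem theorem5:
  fixes d :: nat
    and vs :: "'v list"
    and es :: "('v \<times> 'v) list"
    and y :: "nat \<Rightarrow> complex"
  defines "A \<equiv> incidence_matrix vs es"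
  defines "g \<equiv> gcd_maximal_minors A"
  assumes "d \<ge> 2"
    and "connected_graph vs es"
    and "y \<in> {..<length es} \<rightarrow> roots_of_one d"
  shows "((\<exists>x. x \<in> vertex_solutions d vs es y) \<longleftrightarrow>
           (\<forall>u \<in> kernel_mod d A. (\<Prod>i < length es. y i powi (u $ i)) = 1)) \<and>
         ((\<exists>x. x \<in> vertex_solutions d vs es y) \<longrightarrow>
           card (vertex_solutions d vs es y) =
             (if g = 0 then d else if g = 2 \<and> even d then 2 else 1))"
proof -
  have d: "d > 0" using assms(3) by simp
  have ll: "loopless_graph vs es" using assms(4) by (simp add: connected_graph_def)
  have y: "y i \<in> roots_of_one d" if "i < length es" for i using assms(5) that by auto
  show ?thesis
    unfolding g_def A_def
    using monomial_kernel_eq_1[OF ll d] vertex_solution_exists[where y = y, OF assms(4) d y]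
      card_vertex_solutions[OF assms(4) d _ refl] by blast
qed

end
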